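(* Let $G$ and $H$ be finite simple undirected graphs, where $G$ has $s_1$ vertices and $t_1$ edges and $H$ has $s_2$ vertices. Then $$Mo(G[H])\le\begin{cases} s_2^3\,Mo(G)+s_1\,irr(H)+\dfrac{t_1}{6}\left(2s_2^3-3s_2^2-2s_2+3\right), & \text{if } s_2 \text{ is odd},\\[2mm] s_2^3\,Mo(G)+s_1\,irr(H)+\dfrac{t_1}{6}\left(2s_2^3-3s_2^2-2s_2\right), & \text{if } s_2 \text{ is even}.\end{cases}$$
   Context: For a graph $X$ and an edge $e=uv$ of $X$, $n_u(e\mid X)$ denotes the number of vertices $w$ of $X$ with $d_X(w,u)<d_X(w,v)$ ($d_X$ the shortest-path distance). The Mostar index is $Mo(X)=\sum_{uv\in E(X)}|n_u(e\mid X)-n_v(e\mid X)|$. The irregularity is $irr(X)=\sum_{uv\in E(X)}|\deg_X(u)-\deg_X(v)|$. The lexicographic product $G[H]$ has vertex set $V(G)\times V(H)$, with $(a,b)(a',b')$ an edge iff either $aa'\in E(G)$, or $a=a'$ and $bb'\in E(H)$.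
   Formalization: The formal theorem additionally assumes that G has no isolated vertices; without this the bound fails, e.g. for G = K_1 and H = P_4, where Mo(G[H]) = 4 but the right-hand side is 2. *)

theory Defs
  imports Complex_Main "Graph_Theory.Graph_Theory"
begin

text \<open>
  Finite simple undirected graphs are the \<^locale>\<open>pair_graph\<close>s of Graph_Theory: finite, loop-free,
  symmetric digraphs whose arcs are pairs of vertices. An undirected edge is thus represented by
  its two orientations.
\<close>

definition uedges :: "'a pair_pre_digraph \<Rightarrow> 'a set set" where
  "uedges X = {{u, v} | u v. (u, v) \<in> parcs X}"

text \<open>Shortest-path distance; it is \<open>\<infinity>\<close> between vertices in different components.\<close>

definition gdist :: "'a pair_pre_digraph \<Rightarrow> 'a \<Rightarrow> 'a \<Rightarrow> ereal" where
  "gdist X u v = wf_digraph.\<mu> (with_proj X) (\<lambda>_. 1) u v"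

definition closer :: "'a pair_pre_digraph \<Rightarrow> 'a \<Rightarrow> 'a \<Rightarrow> nat" where
  "closer X u v = card {w \<in> pverts X. gdist X w u < gdist X w v}"

text \<open>In a symmetric digraph the out-degree of a vertex is its degree.\<close>

definition deg :: "'a pair_pre_digraph \<Rightarrow> 'a \<Rightarrow> nat" where
  "deg X v = out_degree (with_proj X) v"

text \<open>
  The factor \<open>1/2\<close> in the next two definitions accounts for each undirected edge being visited
  once in each orientation; see \<open>sum_uedges\<close> below.
\<close>

definition Mostar :: "'a pair_pre_digraph \<Rightarrow> real" where
  "Mostar X = (\<Sum>(u, v)\<in>parcs X. \<bar>real (closer X u v) - real (closer X v u)\<bar>) / 2"

definition irr :: "'a pair_pre_digraph \<Rightarrow> real" where
  "irr X = (\<Sum>(u, v)\<in>parcs X. \<bar>real (deg X u) - real (deg X v)\<bar>) / 2"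

definition lex_product :: "'a pair_pre_digraph \<Rightarrow> 'b pair_pre_digraph \<Rightarrow> ('a \<times> 'b) pair_pre_digraph"
  where
  "lex_product G H = \<lparr>
     pverts = pverts G \<times> pverts H,
     parcs = {((a, b), (a', b')) | a b a' b'.
       (a, b) \<in> pverts G \<times> pverts H \<and> (a', b') \<in> pverts G \<times> pverts H \<and>
       ((a, a') \<in> parcs G \<or> a = a' \<and> (b, b') \<in> parcs H)} \<rparr>"

lemma sum_uedges:
  fixes f :: "'a \<Rightarrow> 'a \<Rightarrow> real" and g :: "'a set \<Rightarrow> real"
  assumes "pair_graph X" and g: "\<And>u v. (u, v) \<in> parcs X \<Longrightarrow> g {u, v} = f u v"
  shows "(\<Sum>(u, v)\<in>parcs X. f u v) / 2 = (\<Sum>e\<in>uedges X. g e)"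
proof -
  interpret pair_graph X by fact
  let ?h = "\<lambda>(u, v). {u, v}"
  have im: "uedges X = ?h ` parcs X" by (auto simp: uedges_def)
  have fin: "finite (parcs X)" by (rule pair_finite_arcs)
  have fib: "(\<Sum>p\<in>{p \<in> parcs X. ?h p = e}. case_prod f p) = 2 * g e" if e: "e \<in> uedges X" for e
  proof -
    from e obtain u v where uv: "(u, v) \<in> parcs X" "e = {u, v}" by (auto simp: uedges_def)
    have vu: "(v, u) \<in> parcs X"
      using arcs_ends_symmetric[OF pair_sym_arcs, of u v] uv(1) by simp
    have ne: "u \<noteq> v" using pair_no_loops[OF uv(1)] by simp
    have "{p \<in> parcs X. ?h p = e} = {(u, v), (v, u)}"
    proof (rule set_eqI)
      fix p
      show "p \<in> {p \<in> parcs X. ?h p = e} \<longleftrightarrow> p \<in> {(u, v), (v, u)}"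
        by (cases p) (use uv(1) vu in \<open>auto simp only: uv(2) doubleton_eq_iff mem_Collect_eq
              prod.case insert_iff empty_iff prod.inject\<close>)
    qed
    then have "(\<Sum>p\<in>{p \<in> parcs X. ?h p = e}. case_prod f p) = f u v + f v u"
      using ne by simp
    moreover have "f u v = g e" using g[OF uv(1)] by (simp only: uv(2))
    moreover have "f v u = g e" using g[OF vu] by (simp only: uv(2) insert_commute)
    ultimately show ?thesis by simp
  qed
  have "(\<Sum>p\<in>parcs X. case_prod f p)
      = (\<Sum>e\<in>uedges X. \<Sum>p\<in>{p \<in> parcs X. ?h p = e}. case_prod f p)"
    unfolding im by (rule sum.image_gen[OF fin])
  also have "\<dots> = 2 * (\<Sum>e\<in>uedges X. g e)"
    by (simp add: fib sum_distrib_left)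
  finally show ?thesis by simp
qed

lemma pair_graph_lex_product:
  assumes "pair_graph G" and "pair_graph H"
  shows "pair_graph (lex_product G H)"
proof -
  interpret G: pair_graph G by fact
  interpret H: pair_graph H by fact
  have symG: "(a, a') \<in> parcs G \<Longrightarrow> (a', a) \<in> parcs G" for a a'
    using arcs_ends_symmetric[OF G.pair_sym_arcs, of a a'] by simp
  have symH: "(b, b') \<in> parcs H \<Longrightarrow> (b', b) \<in> parcs H" for b b'
    using arcs_ends_symmetric[OF H.pair_sym_arcs, of b b'] by simp
  let ?V = "pverts G \<times> pverts H"
  have "finite ?V" using G.pair_finite_verts H.pair_finite_verts by simp
  have sub: "parcs (lex_product G H) \<subseteq> ?V \<times> ?V" by (auto simp: lex_product_def)
  have fin: "finite (parcs (lex_product G H))"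
    by (rule finite_subset[OF sub]) (simp add: \<open>finite ?V\<close>)
  have ne: "p \<noteq> q" if "(p, q) \<in> parcs (lex_product G H)" for p q
    using that G.pair_no_loops H.pair_no_loops by (fastforce simp: lex_product_def)
  show ?thesis
  proof
    show "finite (pverts (lex_product G H))"
      using \<open>finite ?V\<close> by (simp add: lex_product_def)
    show "finite (parcs (lex_product G H))" by (rule fin)
    show "symmetric (with_proj (lex_product G H))"
      unfolding symmetric_def sym_def with_proj_simps using symG symH
      by (simp add: lex_product_def) blast
  next
    fix e assume e: "e \<in> parcs (lex_product G H)"
    show "fst e \<in> pverts (lex_product G H)" "snd e \<in> pverts (lex_product G H)"
      using subsetD[OF sub e] by (auto simp: lex_product_def)
    show "fst e \<noteq> snd e" using e ne by (cases e) simp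
  qed
qed

end

theory Submission
  imports Defs
begin

text \<open>
  Since \<open>G\<close> has no isolated vertex, vertices of \<open>G[H]\<close> in different fibres have the distance of
  their projections to \<open>G\<close>, and distances within a fibre are \<open>0\<close>, \<open>1\<close> or \<open>2\<close>. Hence an edge inside
  a fibre contributes the degree difference of its ends in \<open>H\<close>, and these add up to \<open>s\<^sub>1 irr(H)\<close>,
  whereas for \<open>aa' \<in> E(G)\<close> the number of vertices closer to \<open>(a, b)\<close> than to \<open>(a', b')\<close> is
  \<open>s\<^sub>2 n\<^sub>a - deg b'\<close>, so that this edge contributes at most
  \<open>s\<^sub>2 \<bar>n\<^sub>a - n\<^sub>a\<^sub>'\<bar> + \<bar>deg b - deg b'\<bar>\<close>. What remains is to bound the sum of
  \<open>\<bar>deg b - deg b'\<bar>\<close> over all pairs: with the degrees sorted increasingly as \<open>d\<^sub>0, \<dots>, d\<^sub>n\<^sub>-\<^sub>1\<close> it is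
  \<open>2 \<Sum>\<^sub>i (2 i + 1 - n) d\<^sub>i\<close>, which is the sum of \<open>2 (i + j + 1 - n)\<close> over all adjacent ordered pairs
  and therefore at most the sum of the positive terms over all pairs \<open>i \<noteq> j\<close>.
\<close>

section \<open>Sums over pairs of indices\<close>

text \<open>By monotonicity \<open>d i\<close> enters with a plus sign in \<open>i\<close> of the
  unordered pairs and with a minus sign in the other \<open>n - 1 - i\<close>, whence its
  coefficient; the factor 2 counts ordered pairs.\<close>

lemma sum_abs_diff_mono:
  fixes d :: "nat \<Rightarrow> real"
  assumes "\<And>i j. i \<le> j \<Longrightarrow> j < n \<Longrightarrow> d i \<le> d j"
  shows "(\<Sum>i<n. \<Sum>j<n. \<bar>d i - d j\<bar>) = 2 * (\<Sum>i<n. (2 * real i + 1 - real n) * d i)"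
  using assms
proof (induction n)
  case (Suc n)
  have abs1: "(\<Sum>i<n. \<bar>d i - d n\<bar>) = (\<Sum>i<n. d n - d i)"
    by (intro sum.cong refl) (simp add: Suc.prems)
  have abs2: "(\<Sum>i<n. \<bar>d n - d i\<bar>) = (\<Sum>i<n. d n - d i)"
    using abs1 by (simp add: abs_minus_commute)
  have IH: "(\<Sum>i<n. \<Sum>j<n. \<bar>d i - d j\<bar>) = 2 * (\<Sum>i<n. (2 * real i + 1 - real n) * d i)"
    by (rule Suc.IH) (use Suc.prems in auto)
  have "(\<Sum>i<Suc n. (2 * real i + 1 - real (Suc n)) * d i)
      = (\<Sum>i<n. (2 * real i + 1 - real n) * d i - d i) + real n * d n"
    by (simp add: algebra_simps)
  then show ?case
    by (simp add: sum.distrib abs1 abs2 IH sum_subtractf)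
qed simp

text \<open>Passing from \<open>n\<close> to \<open>Suc n\<close> shifts each row by one column and
  puts a 0 in front, so the old rows keep their sums and only the new row adds 1 + ... + n.\<close>

lemma sum_max_pairs:
  "(\<Sum>i<n. \<Sum>j<n. max 0 (real i + real j + 1 - real n)) = (real n ^ 3 - real n) / 6"
proof (induction n)
  case (Suc n)
  have row: "(\<Sum>j<Suc n. max 0 (real i + real j + 1 - real (Suc n)))
      = (\<Sum>j<n. max 0 (real i + real j + 1 - real n))" if "i < Suc n" for i
    using that by (subst sum.lessThan_Suc_shift) (simp add: algebra_simps)
  have top: "(\<Sum>j<m. max 0 (real n + real j + 1 - real n)) = real m * (real m + 1) / 2" for m
    by (induction m) (simp_all add: field_simps)
  have "(\<Sum>i<Suc n. \<Sum>j<Suc n. max 0 (real i + real j + 1 - real (Suc n)))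
      = (\<Sum>i<Suc n. \<Sum>j<n. max 0 (real i + real j + 1 - real n))"
    by (rule sum.cong[OF refl], rule row) simp
  also have "\<dots> = (real n ^ 3 - real n) / 6 + real n * (real n + 1) / 2"
    by (simp only: sum.lessThan_Suc Suc.IH top)
  also have "\<dots> = (real (Suc n) ^ 3 - real (Suc n)) / 6"
    by (simp add: field_simps power3_eq_cube)
  finally show ?case .
qed simp

text \<open>Steps of two keep the parity of \<open>n\<close> and shift the index by one: the new
  first term is 0 and the new last term is \<open>n + 1\<close>.\<close>

lemma sum_max_diag:
  "(\<Sum>i<n. max 0 (2 * real i + 1 - real n)) = (real n ^ 2 - of_bool (odd n)) / 4"
proof (induction n rule: induct_nat_012)
  case (ge2 n)
  have "(\<Sum>i<Suc (Suc n). max 0 (2 * real i + 1 - real (Suc (Suc n))))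
      = (\<Sum>i<n. max 0 (2 * real i + 1 - real n)) + (real n + 1)"
    by (subst sum.lessThan_Suc_shift) (simp add: algebra_simps)
  then show ?case
    using ge2 by (simp add: field_simps power2_eq_square)
qed simp_all

section \<open>Total irregularity of a graph\<close>

context
  fixes X :: "'a pair_pre_digraph"
  assumes X: "pair_graph X"
begin

interpretation pair_graph X by (rule X)

lemma parcs_sym: "(u, v) \<in> parcs X \<Longrightarrow> (v, u) \<in> parcs X"
  using arcs_ends_symmetric[OF pair_sym_arcs, of u v] by simp

lemma parcs_verts: "(u, v) \<in> parcs X \<Longrightarrow> u \<in> pverts X \<and> v \<in> pverts X"
  by (simp add: in_arcsD1 in_arcsD2)

lemma parcs_irrefl: "(u, u) \<notin> parcs X"
  using pair_no_loops[of "(u, u)"] by auto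

lemma deg_eq_card: "deg X v = card {w. (v, w) \<in> parcs X}"
proof -
  have "out_arcs (with_proj X) v = Pair v ` {w. (v, w) \<in> parcs X}"
    by (auto simp: out_arcs_def)
  then show ?thesis
    by (simp add: deg_def out_degree_def card_image inj_on_def)
qed

text \<open>The cubic part comes from the positive weights over all index pairs; deducting the
  diagonal, where a loop-free graph has no arcs, gives the quadratic term and the parity
  correction.\<close>

lemma total_irregularity_le:
  defines "n \<equiv> card (pverts X)"
  shows "(\<Sum>x\<in>pverts X. \<Sum>y\<in>pverts X. \<bar>real (deg X x) - real (deg X y)\<bar>)
    \<le> (2 * real n ^ 3 - 3 * real n ^ 2 - 2 * real n + 3 * of_bool (odd n)) / 6"
proof -
  obtain ys where ys: "set ys = pverts X" "distinct ys"
    using finite_distinct_list pair_finite_verts by blast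
  define e where "e i = sort_key (deg X) ys ! i" for i
  have len: "length ys = n"
    using distinct_card[OF ys(2)] ys(1) by (simp add: n_def)
  have bij: "bij_betw e {..<n} (pverts X)"
    unfolding e_def using bij_betw_nth[of "sort_key (deg X) ys"] ys len by simp
  have reindex: "(\<Sum>x\<in>pverts X. f x) = (\<Sum>i<n. f (e i))" for f :: "'a \<Rightarrow> real"
    using sum.reindex_bij_betw[OF bij, of f] by simp
  define A :: "nat \<Rightarrow> nat \<Rightarrow> real" where "A i j = of_bool ((e i, e j) \<in> parcs X)" for i j
  have A_sym: "A i j = A j i" for i j
    unfolding A_def by (rule arg_cong[where f = of_bool]) (blast intro: parcs_sym)
  define d where "d i = real (deg X (e i))" for i
  have d_mono: "d i \<le> d j" if "i \<le> j" "j < n" for i j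
    using sorted_nth_mono[OF sorted_sort_key[of "deg X" ys], of i j] that len by (simp add: d_def e_def)
  have d_sum: "d i = (\<Sum>j<n. A i j)" for i
  proof -
    have "{w. (e i, w) \<in> parcs X} = pverts X \<inter> {w. (e i, w) \<in> parcs X}"
      using parcs_verts by blast
    then have "d i = (\<Sum>w\<in>pverts X. of_bool ((e i, w) \<in> parcs X))"
      by (simp add: d_def deg_eq_card sum_of_bool_eq)
    then show ?thesis by (simp add: reindex A_def)
  qed
  let ?m = "\<lambda>i j. max 0 (real i + real j + 1 - real n)"
  \<comment> \<open>Since \<open>A\<close> is symmetric, the weight of a pair may be read off either
    index; adding both readings makes the weight symmetric.\<close>
  have swap: "(\<Sum>i<n. \<Sum>j<n. (2 * real i + 1 - real n) * A i j)
      = (\<Sum>i<n. \<Sum>j<n. (2 * real j + 1 - real n) * A i j)"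
    by (subst sum.swap) (simp add: A_sym)
  have "(\<Sum>x\<in>pverts X. \<Sum>y\<in>pverts X. \<bar>real (deg X x) - real (deg X y)\<bar>)
      = 2 * (\<Sum>i<n. (2 * real i + 1 - real n) * d i)"
    unfolding reindex using sum_abs_diff_mono[of n d] d_mono by (simp add: d_def)
  also have "\<dots> = (\<Sum>i<n. \<Sum>j<n. (2 * real i + 1 - real n) * A i j)
      + (\<Sum>i<n. \<Sum>j<n. (2 * real j + 1 - real n) * A i j)"
    by (simp add: d_sum sum_distrib_left swap)
  also have "\<dots> = (\<Sum>i<n. \<Sum>j<n. 2 * ((real i + real j + 1 - real n) * A i j))"
    unfolding sum.distrib[symmetric] by (intro sum.cong refl) (simp add: algebra_simps)
  \<comment> \<open>Entries of \<open>A\<close> are 0 or 1, so each term is at most the positive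
    part of its weight. On the diagonal \<open>A\<close> vanishes, and the subtracted term cancels
    \<open>?m i i\<close> there.\<close>
  also have "\<dots> \<le> (\<Sum>i<n. \<Sum>j<n. 2 * (?m i j - of_bool (i = j) * ?m i i))"
    by (intro sum_mono mult_left_mono) (auto simp: A_def parcs_irrefl)
  also have "\<dots> = 2 * ((\<Sum>i<n. \<Sum>j<n. ?m i j) - (\<Sum>i<n. ?m i i))"
    by (simp add: sum_distrib_left[symmetric] sum_subtractf of_bool_def if_distribR
        if_distrib[of "\<lambda>x. x * _"] del: mult_2)
  also have "(\<Sum>i<n. ?m i i) = (\<Sum>i<n. max 0 (2 * real i + 1 - real n))"
    by simp
  also have "2 * ((\<Sum>i<n. \<Sum>j<n. ?m i j) - (\<Sum>i<n. max 0 (2 * real i + 1 - real n)))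
      = (2 * real n ^ 3 - 3 * real n ^ 2 - 2 * real n + 3 * of_bool (odd n)) / 6"
    unfolding sum_max_pairs sum_max_diag by (simp add: field_simps)
  finally show ?thesis .
qed

section \<open>Distances as least walk lengths\<close>

text \<open>Powers of the arc relation forget the arc lists, so walks can be moved between
  \<open>G\<close> and the product by plain induction. The assumption on \<open>u\<close> matters
  for \<open>n = 0\<close>: an empty walk must start at a vertex.\<close>

lemma awalk_iff_relpow:
  assumes "u \<in> pverts X"
  shows "(\<exists>p. pre_digraph.awalk (with_proj X) u p v \<and> length p = n) \<longleftrightarrow> (u, v) \<in> parcs X ^^ n"
  using assms
proof (induction n arbitrary: u)
  case 0
  then show ?case by (auto simp: awalk_Nil_iff)
next
  case (Suc n)
  have "(\<exists>p. awalk u p v \<and> length p = Suc n)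
      \<longleftrightarrow> (\<exists>w p. awalk u ((u, w) # p) v \<and> length p = n)"
  proof
    assume "\<exists>p. awalk u p v \<and> length p = Suc n"
    then show "\<exists>w p. awalk u ((u, w) # p) v \<and> length p = n"
      by (fastforce simp: length_Suc_conv awalk_Cons_iff)
  next
    assume "\<exists>w p. awalk u ((u, w) # p) v \<and> length p = n"
    then show "\<exists>p. awalk u p v \<and> length p = Suc n"
      by (metis length_Cons)
  qed
  also have "\<dots> \<longleftrightarrow> (\<exists>w. (u, w) \<in> parcs X \<and> (\<exists>p. awalk w p v \<and> length p = n))"
    by (auto simp: awalk_Cons_iff)
  also have "\<dots> \<longleftrightarrow> (u, v) \<in> parcs X ^^ Suc n"
    using Suc.IH parcs_verts by (blast elim: relpow_Suc_E2 intro: relpow_Suc_I2)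
  finally show ?case .
qed

text \<open>With unit costs the cost of a walk is its length. If no walk exists, the infimum of the
  empty set is the required \<infinity>.\<close>

lemma gdist_eq_INF:
  assumes "u \<in> pverts X"
  shows "gdist X u v = (INF n\<in>{n. (u, v) \<in> parcs X ^^ n}. ereal (real n))"
proof -
  have cost: "awalk_cost (\<lambda>_. 1) p = real (length p)" for p :: "('a \<times> 'a) list"
    by (induction p) simp_all
  have "{n. (u, v) \<in> parcs X ^^ n} = length ` {p. awalk u p v}"
    using awalk_iff_relpow[OF assms, of v] by (auto simp: image_iff eq_commute)
  then show ?thesis
    by (simp add: gdist_def \<mu>_def cost image_image)
qed

lemma gdist_eqI:
  assumes "u \<in> pverts X" "(u, v) \<in> parcs X ^^ n" "\<And>k. k < n \<Longrightarrow> (u, v) \<notin> parcs X ^^ k"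
  shows "gdist X u v = ereal (real n)"
  unfolding gdist_eq_INF[OF assms(1)]
proof (rule INF_eqI)
  fix k assume "k \<in> {k. (u, v) \<in> parcs X ^^ k}"
  then show "ereal (real n) \<le> ereal (real k)"
    using assms(3)[of k] by (cases "k < n") auto
qed (use assms(2) in auto)

lemma gdist_self: "u \<in> pverts X \<Longrightarrow> gdist X u u = 0"
  using gdist_eqI[of u u 0] by (simp add: zero_ereal_def)

lemma gdist_adjacent:
  assumes "(u, v) \<in> parcs X"
  shows "gdist X u v = 1"
proof -
  have "u \<in> pverts X" "u \<noteq> v"
    using assms parcs_verts parcs_irrefl by blast+
  then show ?thesis
    using gdist_eqI[of u v 1] assms by (simp add: one_ereal_def)
qed

lemma gdist_two:
  assumes "(u, w) \<in> parcs X" "(w, v) \<in> parcs X" "u \<noteq> v" "(u, v) \<notin> parcs X"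
  shows "gdist X u v = 2"
proof -
  have "(u, v) \<in> parcs X ^^ 2"
    using assms by (auto simp: numeral_2_eq_2)
  moreover have "(u, v) \<notin> parcs X ^^ k" if "k < 2" for k
    using that assms by (auto simp: less_2_cases_iff)
  ultimately show ?thesis
    using gdist_eqI[of u v 2] parcs_verts[OF assms(1)] by simp
qed

end

section \<open>Distances in the lexicographic product\<close>

lemma pverts_lex_product: "pverts (lex_product G H) = pverts G \<times> pverts H"
  by (simp add: lex_product_def)

context
  fixes G :: "'a pair_pre_digraph" and H :: "'b pair_pre_digraph"
  assumes G: "pair_graph G" and H: "pair_graph H"
begin

interpretation G: pair_graph G by (rule G)
interpretation H: pair_graph H by (rule H)

lemma parcs_lex_product_iff:
  "((a, b), (a', b')) \<in> parcs (lex_product G H) \<longleftrightarrow>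
    (a, b) \<in> pverts G \<times> pverts H \<and> (a', b') \<in> pverts G \<times> pverts H \<and>
    ((a, a') \<in> parcs G \<or> a = a' \<and> (b, b') \<in> parcs H)"
  by (simp add: lex_product_def)

text \<open>Each step of the product projects to an arc of \<open>G\<close> or stays in its fibre,
  so projecting a walk can only shorten it.\<close>

lemma relpow_lex_productD:
  "(p, q) \<in> parcs (lex_product G H) ^^ n \<Longrightarrow> \<exists>k\<le>n. (fst p, fst q) \<in> parcs G ^^ k"
proof (induction n arbitrary: q)
  case (Suc n)
  then obtain r where r: "(p, r) \<in> parcs (lex_product G H) ^^ n" "(r, q) \<in> parcs (lex_product G H)"
    by (auto elim: relpow_Suc_E)
  from Suc.IH[OF r(1)] obtain k where k: "k \<le> n" "(fst p, fst r) \<in> parcs G ^^ k"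
    by blast
  have "(fst r, fst q) \<in> parcs G \<or> fst r = fst q"
    using r(2) parcs_lex_product_iff[of "fst r" "snd r" "fst q" "snd q"] by auto
  then show ?case
  proof
    assume "(fst r, fst q) \<in> parcs G"
    then have "(fst p, fst q) \<in> parcs G ^^ Suc k"
      by (rule relpow_Suc_I[OF k(2)])
    then show ?thesis using k(1) by (intro exI[of _ "Suc k"]) simp
  next
    assume "fst r = fst q"
    then show ?thesis using k by (intro exI[of _ k]) simp
  qed
qed simp

text \<open>An arc of \<open>G\<close> lifts with arbitrary second coordinates at both ends. At
  least one step is required, because the empty walk cannot change \<open>b\<close> into
  \<open>b'\<close>.\<close>

lemma relpow_lex_productI:
  assumes "(a, a') \<in> parcs G ^^ n" "0 < n" "b \<in> pverts H" "b' \<in> pverts H"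
  shows "((a, b), (a', b')) \<in> parcs (lex_product G H) ^^ n"
  using assms
proof (induction n arbitrary: a' b')
  case (Suc n)
  then obtain c where c: "(a, c) \<in> parcs G ^^ n" "(c, a') \<in> parcs G"
    by (auto elim: relpow_Suc_E)
  have step: "((c, d), (a', b')) \<in> parcs (lex_product G H)" if "d \<in> pverts H" for d
    using that c(2) parcs_verts[OF G c(2)] Suc.prems by (simp add: parcs_lex_product_iff)
  show ?case
  proof (cases n)
    case 0
    then show ?thesis using c step[OF Suc.prems(3)] by simp
  next
    case (Suc m)
    then have "((a, b), (c, b')) \<in> parcs (lex_product G H) ^^ n"
      using Suc.IH c Suc.prems by simp
    then show ?thesis
      using step[OF Suc.prems(4)] by (rule relpow_Suc_I)
  qed
qed simp

text \<open>Lifting walks gives one inequality and projecting them the other;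
  \<open>c \<noteq> a\<close> ensures that the walks to be lifted are nonempty.\<close>

lemma gdist_lex_product_neq:
  assumes "c \<in> pverts G" "d \<in> pverts H" "b \<in> pverts H" "c \<noteq> a"
  shows "gdist (lex_product G H) (c, d) (a, b) = gdist G c a"
proof -
  have cd: "(c, d) \<in> pverts (lex_product G H)"
    using assms by (simp add: pverts_lex_product)
  show ?thesis
    unfolding gdist_eq_INF[OF pair_graph_lex_product[OF G H] cd] gdist_eq_INF[OF G assms(1)]
  proof (rule antisym; rule INF_greatest)
    fix n assume n: "n \<in> {n. (c, a) \<in> parcs G ^^ n}"
    then have "0 < n"
      using assms(4) by (cases n) auto
    then have "((c, d), (a, b)) \<in> parcs (lex_product G H) ^^ n"
      using n assms by (intro relpow_lex_productI) auto
    then show "(INF n\<in>{n. ((c, d), (a, b)) \<in> parcs (lex_product G H) ^^ n}. ereal (real n))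
        \<le> ereal (real n)"
      by (intro INF_lower) simp
  next
    fix n assume "n \<in> {n. ((c, d), (a, b)) \<in> parcs (lex_product G H) ^^ n}"
    then obtain k where "k \<le> n" "(c, a) \<in> parcs G ^^ k"
      using relpow_lex_productD by fastforce
    then show "(INF n\<in>{n. (c, a) \<in> parcs G ^^ n}. ereal (real n)) \<le> ereal (real n)"
      by (intro INF_lower2[of k]) auto
  qed
qed

text \<open>The fibre over a neighbour \<open>a'\<close> offers a detour of length two between any
  two vertices of the fibre over \<open>a\<close>, however far apart they are in
  \<open>H\<close>.\<close>

lemma gdist_lex_product_fibre:
  assumes "(a, a') \<in> parcs G" "d \<in> pverts H" "b \<in> pverts H"
  shows "gdist (lex_product G H) (a, d) (a, b)
    = (if d = b then 0 else if (d, b) \<in> parcs H then 1 else 2)"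
proof -
  note a = parcs_verts[OF G assms(1)]
  have "gdist (lex_product G H) (a, d) (a, b) = 2" if "d \<noteq> b" "(d, b) \<notin> parcs H"
  proof (rule gdist_two[OF pair_graph_lex_product[OF G H], of _ "(a', b)"])
    show "((a, d), (a', b)) \<in> parcs (lex_product G H)"
      "((a', b), (a, b)) \<in> parcs (lex_product G H)"
      using assms a parcs_sym[OF G assms(1)] by (simp_all add: parcs_lex_product_iff)
    show "((a, d), (a, b)) \<notin> parcs (lex_product G H)"
      using that parcs_irrefl[OF G] by (simp add: parcs_lex_product_iff)
  qed (use that in simp)
  moreover have "gdist (lex_product G H) (a, d) (a, b) = 1" if "(d, b) \<in> parcs H"
    using that assms a by (intro gdist_adjacent[OF pair_graph_lex_product[OF G H]])
      (simp add: parcs_lex_product_iff)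
  moreover have "gdist (lex_product G H) (a, d) (a, b) = 0" if "d = b"
    using that assms a gdist_self[OF pair_graph_lex_product[OF G H]] by (simp add: pverts_lex_product)
  ultimately show ?thesis
    by auto
qed

section \<open>Counting closer vertices\<close>

text \<open>Every vertex of \<open>G\<close> closer to \<open>a\<close>, other than \<open>a\<close>
  itself, contributes a whole fibre. The fibre over \<open>a\<close> is at distance 1 from
  \<open>(a', b')\<close>, so only \<open>(a, b)\<close> counts there; the fibre over
  \<open>a'\<close> is at distance 1 from \<open>(a, b)\<close>, so exactly its vertices at distance
  2 from \<open>(a', b')\<close> count, those outside the closed neighbourhood of
  \<open>b'\<close>.\<close>

lemma closer_lex_product_adjacent:
  assumes aa': "(a, a') \<in> parcs G" and b: "b \<in> pverts H" and b': "b' \<in> pverts H"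
  shows "real (closer (lex_product G H) (a, b) (a', b'))
    = real (card (pverts H)) * real (closer G a a') - real (deg H b')"
proof -
  note a = parcs_verts[OF G aa']
  have a'a: "(a', a) \<in> parcs G"
    using aa' by (rule parcs_sym[OF G])
  have ne: "a \<noteq> a'"
    using aa' parcs_irrefl[OF G] by blast
  define W where "W = {w \<in> pverts G. w \<noteq> a \<and> w \<noteq> a' \<and> gdist G w a < gdist G w a'}"
  have finW: "finite W"
    by (simp add: W_def)
  have "{w \<in> pverts G. gdist G w a < gdist G w a'} = insert a W"
    using a by (auto simp: W_def gdist_self[OF G] gdist_adjacent[OF G aa'] gdist_adjacent[OF G a'a])
  then have closer_G: "closer G a a' = Suc (card W)"
    using finW by (simp add: closer_def W_def)
  let ?N = "insert b' {w. (b', w) \<in> parcs H}"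
  have N: "?N \<subseteq> pverts H"
    using b' parcs_verts[OF H] by blast
  then have finN: "finite ?N"
    by (rule finite_subset) simp
  have cardN: "card ?N = Suc (deg H b')"
    using finN parcs_irrefl[OF H] by (simp add: deg_eq_card[OF H])
  have "w \<in> {w \<in> pverts (lex_product G H).
        gdist (lex_product G H) w (a, b) < gdist (lex_product G H) w (a', b')}
      \<longleftrightarrow> w \<in> W \<times> pverts H \<union> {(a, b)} \<union> {a'} \<times> (pverts H - ?N)" for w
  proof (cases w)
    case (Pair c d)
    show ?thesis
    proof (cases "c \<in> pverts G \<and> d \<in> pverts H")
      case True
      have sym: "(d, b') \<in> parcs H \<longleftrightarrow> (b', d) \<in> parcs H"
        by (blast intro: parcs_sym[OF H])
      consider "c = a" | "c = a'" | "c \<noteq> a" "c \<noteq> a'" by blast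
      then show ?thesis
      proof cases
        case 1
        then show ?thesis
          using True ne b b' a gdist_lex_product_fibre[OF aa' _ b, of d]
            gdist_lex_product_neq[of a d b' a'] gdist_adjacent[OF G aa']
          by (simp add: Pair pverts_lex_product W_def)
      next
        case 2
        then show ?thesis
          using True ne b b' a gdist_lex_product_fibre[OF a'a _ b', of d]
            gdist_lex_product_neq[of a' d b a] gdist_adjacent[OF G a'a]
          by (simp add: Pair pverts_lex_product W_def sym)
      next
        case 3
        then show ?thesis
          using True b b' by (simp add: Pair pverts_lex_product W_def gdist_lex_product_neq)
      qed
    next
      case False
      then show ?thesis using a b by (auto simp: Pair pverts_lex_product W_def)
    qed
  qed
  then have "closer (lex_product G H) (a, b) (a', b')
      = card (W \<times> pverts H \<union> {(a, b)} \<union> {a'} \<times> (pverts H - ?N))"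
    unfolding closer_def by (intro arg_cong[where f = card] set_eqI)
  also have "\<dots> = card W * card (pverts H) + 1 + (card (pverts H) - Suc (deg H b'))"
  proof -
    have "card (W \<times> pverts H \<union> {(a, b)}) = card W * card (pverts H) + 1"
      by (subst card_Un_disjoint) (auto simp: finW card_cartesian_product, auto simp: W_def)
    moreover have "card ({a'} \<times> (pverts H - ?N)) = card (pverts H) - Suc (deg H b')"
      by (simp only: card_cartesian_product card_Diff_subset[OF finN N] cardN) simp
    moreover have "(W \<times> pverts H \<union> {(a, b)}) \<inter> {a'} \<times> (pverts H - ?N) = {}"
      using ne by (auto simp: W_def)
    ultimately show ?thesis
      using finW by (subst card_Un_disjoint) auto
  qed
  finally have "closer (lex_product G H) (a, b) (a', b') = \<dots>" .
  \<comment> \<open>This makes the natural-number subtraction in the count exact.\<close>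
  moreover have "Suc (deg H b') \<le> card (pverts H)"
    using card_mono[OF _ N] cardN by simp
  ultimately show ?thesis
    by (simp add: closer_G algebra_simps of_nat_diff)
qed

text \<open>Vertices of other fibres are equidistant from both ends. Inside the fibre, where
  distances are at most 2, what counts is \<open>b\<close> and those neighbours of \<open>b\<close>
  that are neither \<open>b'\<close> nor adjacent to \<open>b'\<close>. The common neighbours are
  symmetric in \<open>b\<close> and \<open>b'\<close>, so they cancel in the difference of the two
  counts.\<close>

lemma closer_lex_product_fibre:
  assumes aa': "(a, a') \<in> parcs G" and bb': "(b, b') \<in> parcs H"
  shows "real (closer (lex_product G H) (a, b) (a, b'))
    = real (deg H b) - real (card {w. (b, w) \<in> parcs H \<and> (b', w) \<in> parcs H})"
proof -
  note a = parcs_verts[OF G aa'] and b = parcs_verts[OF H bb']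
  have b'b: "(b', b) \<in> parcs H"
    using bb' by (rule parcs_sym[OF H])
  let ?N = "{w. (b, w) \<in> parcs H}" and ?N' = "{w. (b', w) \<in> parcs H}"
  have fin: "finite ?N" "finite ?N'"
    by (rule finite_subset[of _ "pverts H"]; use parcs_verts[OF H] in auto)+
  have "w \<in> {w \<in> pverts (lex_product G H).
        gdist (lex_product G H) w (a, b) < gdist (lex_product G H) w (a, b')}
      \<longleftrightarrow> w \<in> {a} \<times> insert b (?N - ?N' - {b'})" for w
  proof (cases w)
    case (Pair c d)
    show ?thesis
    proof (cases "c \<in> pverts G \<and> d \<in> pverts H")
      case True
      have sym: "(d, x) \<in> parcs H \<longleftrightarrow> (x, d) \<in> parcs H" for x
        by (blast intro: parcs_sym[OF H])
      show ?thesis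
      proof (cases "c = a")
        case True
        then show ?thesis
          using \<open>c \<in> pverts G \<and> d \<in> pverts H\<close> b a bb' b'b parcs_irrefl[OF H]
            gdist_lex_product_fibre[OF aa', of d]
          by (auto simp: Pair pverts_lex_product sym)
      next
        case False
        then show ?thesis
          using True b by (simp add: Pair pverts_lex_product gdist_lex_product_neq)
      qed
    next
      case False
      then show ?thesis using a b parcs_verts[OF H] by (auto simp: Pair pverts_lex_product)
    qed
  qed
  then have "closer (lex_product G H) (a, b) (a, b') = card ({a} \<times> insert b (?N - ?N' - {b'}))"
    unfolding closer_def by (intro arg_cong[where f = card] set_eqI)
  also have "\<dots> = Suc (card (?N - ?N' - {b'}))"
    using fin parcs_irrefl[OF H] by (simp add: card_cartesian_product)
  \<comment> \<open>The extra vertex \<open>b\<close> makes up for \<open>b'\<close>, which lies in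
    \<open>?N\<close> but, for lack of loops, not in \<open>?N'\<close>.\<close>
  also have "\<dots> = card (?N - ?N')"
    using fin bb' parcs_irrefl[OF H] by (intro card_Suc_Diff1) auto
  also have "\<dots> = card ?N - card (?N \<inter> ?N')"
    using fin by (intro card_Diff_subset_Int) simp
  finally have "closer (lex_product G H) (a, b) (a, b') = deg H b - card (?N \<inter> ?N')"
    by (simp add: deg_eq_card[OF H])
  moreover have "card (?N \<inter> ?N') \<le> deg H b"
    unfolding deg_eq_card[OF H] by (rule card_mono) (use fin in auto)
  ultimately show ?thesis
    by (simp add: of_nat_diff Int_def)
qed

section \<open>Splitting the edge sum and the final bound\<close>

text \<open>Arcs between fibres carry an arc of \<open>G\<close> and two free coordinates, arcs
  inside a fibre carry an arc of \<open>H\<close>; the two kinds are disjoint since \<open>G\<close>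
  has no loops.\<close>

lemma sum_parcs_lex_product:
  fixes f :: "'a \<times> 'b \<Rightarrow> 'a \<times> 'b \<Rightarrow> real"
  shows "(\<Sum>(p, q)\<in>parcs (lex_product G H). f p q)
    = (\<Sum>(a, a')\<in>parcs G. \<Sum>b\<in>pverts H. \<Sum>b'\<in>pverts H. f (a, b) (a', b'))
      + (\<Sum>a\<in>pverts G. \<Sum>(b, b')\<in>parcs H. f (a, b) (a, b'))"
proof -
  let ?A = "parcs G \<times> (pverts H \<times> pverts H)" and ?B = "pverts G \<times> parcs H"
  let ?i = "\<lambda>((a, a'), (b, b')). ((a, b), (a', b'))" and ?j = "\<lambda>(a, (b, b')). ((a, b), (a, b'))"
  have L_eq: "parcs (lex_product G H) = ?i ` ?A \<union> ?j ` ?B"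
  proof (rule set_eqI)
    fix e :: "('a \<times> 'b) \<times> ('a \<times> 'b)"
    obtain a b a' b' where e: "e = ((a, b), (a', b'))"
      by (metis surj_pair)
    show "e \<in> parcs (lex_product G H) \<longleftrightarrow> e \<in> ?i ` ?A \<union> ?j ` ?B"
      unfolding e parcs_lex_product_iff
      by (auto simp: image_iff Bex_def dest: parcs_verts[OF G] parcs_verts[OF H])
  qed
  have "(\<Sum>(p, q)\<in>parcs (lex_product G H). f p q)
      = (\<Sum>(p, q)\<in>?i ` ?A. f p q) + (\<Sum>(p, q)\<in>?j ` ?B. f p q)"
    unfolding L_eq
    by (rule sum.union_disjoint) (auto simp: parcs_irrefl[OF G])
  also have "(\<Sum>(p, q)\<in>?i ` ?A. f p q) = (\<Sum>((a, a'), (b, b'))\<in>?A. f (a, b) (a', b'))"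
    by (subst sum.reindex) (auto simp: inj_on_def intro!: sum.cong)
  also have "\<dots> = (\<Sum>(a, a')\<in>parcs G. \<Sum>b\<in>pverts H. \<Sum>b'\<in>pverts H. f (a, b) (a', b'))"
    by (simp add: sum.cartesian_product case_prod_unfold)
  also have "(\<Sum>(p, q)\<in>?j ` ?B. f p q) = (\<Sum>(a, (b, b'))\<in>?B. f (a, b) (a, b'))"
    by (subst sum.reindex) (auto simp: inj_on_def intro!: sum.cong)
  also have "\<dots> = (\<Sum>a\<in>pverts G. \<Sum>(b, b')\<in>parcs H. f (a, b) (a, b'))"
    by (simp add: sum.cartesian_product case_prod_unfold)
  finally show ?thesis .
qed

end

lemma card_parcs:
  assumes "pair_graph X"
  shows "card (parcs X) = 2 * card (uedges X)"
  using sum_uedges[OF assms, of "\<lambda>_. 1" "\<lambda>_ _. 1"] by (simp add: case_prod_unfold)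

theorem theorem4:
  fixes G :: "'a pair_pre_digraph" and H :: "'b pair_pre_digraph"
    and s1 t1 s2 :: nat
  assumes "pair_graph G" and "pair_graph H"
    and "s1 = card (pverts G)" and "t1 = card (uedges G)" and "s2 = card (pverts H)"
    and no_isolated: "\<And>a. a \<in> pverts G \<Longrightarrow> \<exists>a'. (a, a') \<in> parcs G"
  shows "Mostar (lex_product G H) \<le>
    (if odd s2
     then real s2 ^ 3 * Mostar G + real s1 * irr H
        + real t1 / 6 * (2 * real s2 ^ 3 - 3 * real s2 ^ 2 - 2 * real s2 + 3)
     else real s2 ^ 3 * Mostar G + real s1 * irr H
        + real t1 / 6 * (2 * real s2 ^ 3 - 3 * real s2 ^ 2 - 2 * real s2))"
proof -
  note G = \<open>pair_graph G\<close> and H = \<open>pair_graph H\<close>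
  let ?L = "lex_product G H"
  let ?c = "\<lambda>p q. \<bar>real (closer ?L p q) - real (closer ?L q p)\<bar>"
  let ?m = "\<lambda>a a'. \<bar>real (closer G a a') - real (closer G a' a)\<bar>"
  let ?d = "\<lambda>b b'. \<bar>real (deg H b) - real (deg H b')\<bar>"
  define D where "D = (\<Sum>b\<in>pverts H. \<Sum>b'\<in>pverts H. ?d b b')"
  \<comment> \<open>\<open>B\<close> merges both parities: its last summand is the 3 of the odd
    case.\<close>
  define B where "B = (2 * real s2 ^ 3 - 3 * real s2 ^ 2 - 2 * real s2 + 3 * of_bool (odd s2)) / 6"
  have "D \<le> B"
    unfolding D_def B_def \<open>s2 = _\<close> by (rule total_irregularity_le[OF H])
  \<comment> \<open>The count at one end involves the degree at the other, so the difference of the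
    counts contains \<open>deg H b - deg H b'\<close>.\<close>
  have adjacent: "?c (a, b) (a', b') \<le> real s2 * ?m a a' + ?d b b'"
    if "(a, a') \<in> parcs G" "b \<in> pverts H" "b' \<in> pverts H" for a a' b b'
  proof -
    have "real (closer ?L (a, b) (a', b')) - real (closer ?L (a', b') (a, b))
        = real s2 * (real (closer G a a') - real (closer G a' a)) + (real (deg H b) - real (deg H b'))"
      using that parcs_sym[OF G that(1)]
      by (simp add: closer_lex_product_adjacent[OF G H] \<open>s2 = _\<close> algebra_simps)
    also have "\<bar>\<dots>\<bar> \<le> real s2 * ?m a a' + ?d b b'"
      by (rule order_trans[OF abs_triangle_ineq]) (simp add: abs_mult)
    finally show ?thesis by simp
  qed
  \<comment> \<open>A neighbour of \<open>a\<close> is what collapses distances in its fibre to at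
    most 2; over an isolated vertex the fibre would keep the distances of \<open>H\<close>.\<close>
  have fibre: "?c (a, b) (a, b') = ?d b b'"
    if "a \<in> pverts G" "(b, b') \<in> parcs H" for a b b'
  proof -
    obtain a' where "(a, a') \<in> parcs G"
      using no_isolated[OF \<open>a \<in> pverts G\<close>] by blast
    then show ?thesis
      using closer_lex_product_fibre[OF G H, of a a' b b'] closer_lex_product_fibre[OF G H, of a a' b' b]
        that(2) parcs_sym[OF H that(2)]
      by (simp add: conj_commute)
  qed
  have "(\<Sum>(a, a')\<in>parcs G. \<Sum>b\<in>pverts H. \<Sum>b'\<in>pverts H. ?c (a, b) (a', b'))
      \<le> (\<Sum>(a, a')\<in>parcs G. \<Sum>b\<in>pverts H. \<Sum>b'\<in>pverts H. real s2 * ?m a a' + ?d b b')"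
    using adjacent by (intro sum_mono) (auto intro!: sum_mono)
  \<comment> \<open>The first summand is constant over the \<open>s2 ^ 2\<close> pairs
    \<open>b\<close>, \<open>b'\<close>, which raises \<open>s2\<close> to its cube.\<close>
  also have "\<dots> = (\<Sum>(a, a')\<in>parcs G. real s2 ^ 3 * ?m a a' + D)"
    by (simp add: sum.distrib D_def \<open>s2 = _\<close> power3_eq_cube mult.assoc)
  \<comment> \<open>\<open>G\<close> has \<open>2 * t1\<close> arcs, and \<open>Mostar G\<close> is
    half of its sum over arcs.\<close>
  also have "\<dots> = 2 * (real s2 ^ 3 * Mostar G + real t1 * D)"
    by (simp add: case_prod_unfold sum.distrib sum_distrib_left[symmetric] Mostar_def
        card_parcs[OF G] \<open>t1 = _\<close>)
  also have "\<dots> \<le> 2 * (real s2 ^ 3 * Mostar G + real t1 * B)"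
    using \<open>D \<le> B\<close> by (simp add: mult_left_mono)
  finally have cross: "(\<Sum>(a, a')\<in>parcs G. \<Sum>b\<in>pverts H. \<Sum>b'\<in>pverts H. ?c (a, b) (a', b'))
      \<le> 2 * (real s2 ^ 3 * Mostar G + real t1 * B)" .
  have "(\<Sum>a\<in>pverts G. \<Sum>(b, b')\<in>parcs H. ?c (a, b) (a, b'))
      = (\<Sum>a\<in>pverts G. \<Sum>(b, b')\<in>parcs H. ?d b b')"
    using fibre by (intro sum.cong refl) auto
  also have "\<dots> = 2 * (real s1 * irr H)"
    by (simp add: irr_def \<open>s1 = _\<close>)
  finally have "Mostar ?L \<le> real s2 ^ 3 * Mostar G + real s1 * irr H + real t1 * B"
    using cross by (simp add: Mostar_def[of ?L] sum_parcs_lex_product[OF G H])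
  then show ?thesis
    by (cases "odd s2") (simp_all add: B_def)
qed

end
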